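(* Fix a nonnegative integer $b$ and a rational number $c\in(b,\infty)$. Let $m=m(N)$ satisfy $m(N)\to\infty$ and $m(N)^2/N\to0$ as $N\to\infty$. Then for any site $\ell\in\Lambda_N$ and any $j\in\mathbb N_b$, $$\lim_{N\to\infty}P_{N,b,m}(K_\ell=j)=\rho_{b,\alpha_b(c);j}=\frac{1}{Z_b(\alpha_b(c))}\cdot\frac{[\alpha_b(c)]^j}{j!}.$$
   Context: Notation: $\mathbb N_b=\{n\in\mathbb Z:n\ge b\}$. $N$ ranges only over integers $N\ge2$ for which $K:=cN$ is an integer, and limits $N\to\infty$ are along such $N$. $m=m(N)$ is an integer with $2\le m(N)\le N$. Model: $\Lambda_N=\{1,\dots,N\}$ and $\Omega_N=\Lambda_N^K$ is the set of $\omega=(\omega_1,\dots,\omega_K)$. For $\ell\in\Lambda_N$, $K_\ell(\omega)=\mathrm{card}\{i:\omega_i=\ell\}$; for integers $j\ge0$, $N_j(\omega)=\mathrm{card}\{\ell\in\Lambda_N:K_\ell(\omega)=j\}$; $|N(\omega)|_+=\mathrm{card}\{j\in\mathbb N_b:N_j(\omega)\ge1\}$. Set $\Omega_{N,b,m}=\{\omega\in\Omega_N:K_\ell(\omega)\ge b\ \forall\ell\in\Lambda_N,\ |N(\omega)|_+\le m(N)\}$, and let $P_{N,b,m}$ be the uniform probability measure on $\Omega_{N,b,m}$. In the limit, $\ell$ is a fixed positive integer and $N\ge\ell$. For $\alpha>0$, $\rho_{b,\alpha}$ is the probability measure on $\mathbb N_b$ with $\rho_{b,\alpha;j}=\frac{1}{Z_b(\alpha)}\frac{\alpha^j}{j!}$,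 where $Z_0(\alpha)=e^\alpha$ and $Z_b(\alpha)=e^\alpha-\sum_{j=0}^{b-1}\alpha^j/j!$ for $b\ge1$. $\alpha_b(c)$ is the unique $\alpha\in(0,\infty)$ for which $\rho_{b,\alpha}$ has mean $c$. *)

theory Defs
  imports "HOL-Probability.Probability"
begin

section \<open>The model\<close>

text \<open>
  A configuration of \<open>K\<close> particles on the sites \<open>{1..N}\<close> is a function on the labels \<open>{1..K}\<close>;
  \<^const>\<open>PiE\<close> fixes its (irrelevant) value outside \<open>{1..K}\<close>, so that there are \<open>N ^ K\<close> of them.
\<close>

definition configs :: "nat \<Rightarrow> nat \<Rightarrow> (nat \<Rightarrow> nat) set" where
  "configs N K = {1..K} \<rightarrow>\<^sub>E {1..N}"

definition occupation :: "nat \<Rightarrow> (nat \<Rightarrow> nat) \<Rightarrow> nat \<Rightarrow> nat" where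
  "occupation K \<omega> l = card {i \<in> {1..K}. \<omega> i = l}"

definition num_sites :: "nat \<Rightarrow> nat \<Rightarrow> (nat \<Rightarrow> nat) \<Rightarrow> nat \<Rightarrow> nat" where
  "num_sites N K \<omega> j = card {l \<in> {1..N}. occupation K \<omega> l = j}"

definition num_levels :: "nat \<Rightarrow> nat \<Rightarrow> nat \<Rightarrow> (nat \<Rightarrow> nat) \<Rightarrow> nat" where
  "num_levels N K b \<omega> = card {j \<in> {b..}. num_sites N K \<omega> j \<ge> 1}"

definition restricted_configs :: "nat \<Rightarrow> nat \<Rightarrow> nat \<Rightarrow> nat \<Rightarrow> (nat \<Rightarrow> nat) set" where
  "restricted_configs N K b M =
     {\<omega> \<in> configs N K. (\<forall>l\<in>{1..N}. occupation K \<omega> l \<ge> b) \<and> num_levels N K b \<omega> \<le> M}"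

text \<open>
  The uniform distribution is meaningful only on a nonempty set. If \<open>b * N \<le> K\<close>, \<open>N \<ge> 1\<close> and
  \<open>M \<ge> 2\<close>, the set is nonempty: distribute the particles as evenly as possible.
\<close>

definition microcanonical :: "nat \<Rightarrow> nat \<Rightarrow> nat \<Rightarrow> nat \<Rightarrow> (nat \<Rightarrow> nat) pmf" where
  "microcanonical N K b M = pmf_of_set (restricted_configs N K b M)"

definition admissible :: "real \<Rightarrow> nat set" where
  "admissible c = {N. N \<ge> 2 \<and> c * real N \<in> \<int>}"

definition num_particles :: "real \<Rightarrow> nat \<Rightarrow> nat" where
  "num_particles c N = nat \<lfloor>c * real N\<rfloor>"

lemma real_num_particles:
  assumes "c \<ge> 0" "N \<in> admissible c"
  shows "real (num_particles c N) = c * real N"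
  using assms by (auto simp: num_particles_def admissible_def elim!: Ints_cases)

text \<open>The filter for limits \<open>N \<longlongrightarrow> \<infinity>\<close> along the admissible \<open>N\<close>.\<close>

definition thermodynamic :: "real \<Rightarrow> nat filter" where
  "thermodynamic c = inf sequentially (principal (admissible c))"

lemma thermodynamic_neq_bot:
  assumes "c \<in> \<rat>"
  shows "thermodynamic c \<noteq> bot"
proof -
  obtain p q :: int where q: "q > 0" and c: "c = of_int p / of_int q"
    using assms by (elim Rats_cases') auto
  have "\<exists>N\<ge>n. N \<in> admissible c" for n
  proof (intro exI conjI)
    have q1: "nat q \<ge> 1" using q by simp
    have "(n + 2) * 1 \<le> (n + 2) * nat q" using q1 by (intro mult_le_mono2)
    then show "n \<le> (n + 2) * nat q" by simp
    have "2 \<le> (n + 2) * nat q" by (rule order_trans[OF _ \<open>(n + 2) * 1 \<le> _\<close>]) simp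
    moreover have "c * real ((n + 2) * nat q) = of_int (p * int (n + 2))"
      using q by (simp add: c field_simps)
    ultimately show "(n + 2) * nat q \<in> admissible c"
      unfolding admissible_def by (metis (mono_tags, lifting) Ints_of_int mem_Collect_eq)
  qed
  then show ?thesis
    unfolding thermodynamic_def trivial_limit_def eventually_inf_principal eventually_sequentially
    by auto
qed

section \<open>The truncated Poisson distribution\<close>

text \<open>For \<open>b = 0\<close> the subtracted sum is empty.\<close>

definition Z :: "nat \<Rightarrow> real \<Rightarrow> real" where
  "Z b \<alpha> = exp \<alpha> - (\<Sum>j<b. \<alpha> ^ j / fact j)"

definition rho :: "nat \<Rightarrow> real \<Rightarrow> nat pmf" where
  "rho b \<alpha> = embed_pmf (\<lambda>j. if j \<in> {b..} then 1 / Z b \<alpha> * (\<alpha> ^ j / fact j) else 0)"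

lemma Z_sums:
  "(\<lambda>j. if j \<in> {b..} then \<alpha> ^ j / fact j else 0) sums Z b \<alpha>"
proof -
  have 1: "(\<lambda>j. \<alpha> ^ j / fact j) sums exp \<alpha>"
    using exp_converges[of \<alpha>] by (simp add: divide_inverse mult.commute)
  have 2: "(\<lambda>j. if j \<in> {..<b} then \<alpha> ^ j / fact j else 0) sums (\<Sum>j<b. \<alpha> ^ j / fact j)"
    by (rule sums_If_finite_set) simp
  have "(\<lambda>j. if j \<in> {b..} then \<alpha> ^ j / fact j else 0) =
        (\<lambda>j. \<alpha> ^ j / fact j - (if j \<in> {..<b} then \<alpha> ^ j / fact j else 0))"
    by (auto simp: fun_eq_iff)
  then show ?thesis using sums_diff[OF 1 2] by (simp add: Z_def)
qed

lemma Z_pos: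
  assumes "\<alpha> > 0"
  shows "Z b \<alpha> > 0"
proof -
  have "0 < (\<Sum>j. if j \<in> {b..} then \<alpha> ^ j / fact j else 0)"
    by (rule suminf_pos2[where i = b]) (use assms Z_sums[of b \<alpha>] in \<open>auto simp: sums_iff\<close>)
  then show ?thesis using Z_sums[of b \<alpha>] by (simp add: sums_iff)
qed

lemma pmf_rho:
  assumes "\<alpha> > 0"
  shows "pmf (rho b \<alpha>) j = (if j \<in> {b..} then 1 / Z b \<alpha> * (\<alpha> ^ j / fact j) else 0)"
  unfolding rho_def
proof (rule pmf_embed_pmf)
  let ?f = "\<lambda>j. if j \<in> {b..} then 1 / Z b \<alpha> * (\<alpha> ^ j / fact j) else 0"
  show nonneg: "?f j \<ge> 0" for j
    using Z_pos[OF assms, of b] assms by simp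
  have "?f = (\<lambda>j. 1 / Z b \<alpha> * (if j \<in> {b..} then \<alpha> ^ j / fact j else 0))"
    by auto
  then have "?f sums (1 / Z b \<alpha> * Z b \<alpha>)"
    using sums_mult[OF Z_sums[of b \<alpha>], of "1 / Z b \<alpha>"] by (simp only:)
  then have "?f sums 1"
    using Z_pos[OF assms, of b] by simp
  from suminf_ennreal_eq[OF nonneg this]
  show "(\<integral>\<^sup>+ j. ennreal (?f j) \<partial>count_space UNIV) = 1"
    by (simp only: nn_integral_count_space_nat ennreal_1)
qed

definition alpha :: "nat \<Rightarrow> real \<Rightarrow> real" where
  "alpha b c = (THE \<alpha>. \<alpha> > 0 \<and> measure_pmf.expectation (rho b \<alpha>) real = c)"

end

theory Submission
  imports Defs "HOL-Combinatorics.Multiset_Permutations" "HOL-Real_Asymp.Real_Asymp"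
begin

text \<open>
  Under the uniform measure the occupation numbers are independent truncated Poisson variables,
  with any parameter \<open>\<alpha>\<close>, conditioned on having sum \<open>K\<close> and at most \<open>m\<close> different values. Take
  \<open>\<alpha> = \<alpha>\<^sub>b(c)\<close>. By Hoeffding's inequality the frequency of the value \<open>j\<close> deviates from its mean by
  \<open>\<epsilon>\<close> with unconditional probability at most \<open>2 exp (-2 \<epsilon>\<^sup>2 N)\<close>, so it suffices that the
  conditioning event has probability \<open>exp (-o(N))\<close>. For that, cut the sites into blocks of a fixed
  size \<open>n\<close> and require each block to have sum \<open>c n\<close>: this bounds the occupation numbers by \<open>c n\<close>, and
  its cost per site is small when \<open>n\<close> is large, because \<open>c\<close> is the mean.
\<close>

section \<open>The parameter \<open>\<alpha>\<^sub>b(c)\<close>\<close>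

lemma nat_pmf_expectation_sums:
  fixes f :: "nat \<Rightarrow> real"
  assumes "\<And>n. f n \<ge> 0" and "(\<lambda>n. pmf p n * f n) sums s"
  shows "integrable (measure_pmf p) f" and "measure_pmf.expectation p f = s"
proof -
  have 1: "integrable (count_space UNIV) (\<lambda>n. pmf p n * f n)"
    unfolding integrable_count_space_nat_iff using assms by (simp add: sums_iff)
  show "integrable (measure_pmf p) f"
    unfolding measure_pmf_eq_density by (subst integrable_density) (use 1 in auto)
  show "measure_pmf.expectation p f = s"
    unfolding measure_pmf_eq_density
    by (subst integral_density) (use 1 assms(2) in \<open>auto simp: integral_count_space_nat sums_iff\<close>)
qed

text \<open>\<open>j \<alpha>^j / j!\<close> is \<open>\<alpha>\<close> times the preceding weight,
  so an index shift reproduces the series of \<open>Z b \<alpha>\<close>; the term at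
  \<open>j = b\<close> is left over because its predecessor is truncated.\<close>

lemma first_moment_sums:
  fixes \<alpha> :: real
  shows "(\<lambda>j. real j * (if j \<in> {b..} then \<alpha> ^ j / fact j else 0)) sums
           (\<alpha> * Z b \<alpha> + real b * (\<alpha> ^ b / fact b))"
proof -
  let ?f = "\<lambda>j. real j * (if j \<in> {b..} then \<alpha> ^ j / fact j else 0)"
  \<comment> \<open>For \<open>b = 0\<close> the natural number \<open>b - 1\<close> is
    \<open>0\<close>, but the extra term carries the factor \<open>real b = 0\<close>.\<close>
  have shift: "?f (Suc j) = \<alpha> * (if j \<in> {b..} then \<alpha> ^ j / fact j else 0)
                 + (if j = b - 1 then real b * (\<alpha> ^ b / fact b) else 0)" for j
    by (cases b) (auto simp: divide_simps)
  have "(\<lambda>j. ?f (Suc j)) sums (\<alpha> * Z b \<alpha> + real b * (\<alpha> ^ b / fact b))"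
    unfolding shift
    using sums_add[OF sums_mult[OF Z_sums] sums_single[of "b - 1" "\<lambda>_. real b * (\<alpha> ^ b / fact b)"]]
    by simp
  from sums_Suc[OF this] show ?thesis by simp
qed

text \<open>Since \<open>j^2 \<le> 4^j\<close>, the exponential series at
  \<open>4 * \<alpha>\<close> dominates. The second moment feeds Chebyshev's inequality
  later.\<close>

lemma second_moment_summable:
  fixes \<alpha> :: real
  assumes "\<alpha> > 0"
  shows "summable (\<lambda>j. (real j)\<^sup>2 * (if j \<in> {b..} then \<alpha> ^ j / fact j else 0))"
proof (rule summable_comparison_test')
  show "summable (\<lambda>j. (4 * \<alpha>) ^ j / fact j)"
    using summable_exp[of "4 * \<alpha>"] by (simp add: field_simps)
  fix j :: nat
  have "real j < 2 ^ j" by (rule of_nat_less_two_power)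
  then have "(real j)\<^sup>2 \<le> (2 ^ j)\<^sup>2" by (intro power_mono) auto
  also have "\<dots> = 4 ^ j" by (simp add: power2_eq_square flip: power_mult_distrib)
  finally have "(real j)\<^sup>2 * (\<alpha> ^ j / fact j) \<le> 4 ^ j * (\<alpha> ^ j / fact j)"
    using assms by (intro mult_right_mono) auto
  then show "norm ((real j)\<^sup>2 * (if j \<in> {b..} then \<alpha> ^ j / fact j else 0)) \<le> (4 * \<alpha>) ^ j / fact j"
    using assms by (auto simp: power_mult_distrib)
qed

lemma pmf_rho_eq:
  assumes "\<alpha> > 0"
  shows "pmf (rho b \<alpha>) = (\<lambda>j. 1 / Z b \<alpha> * (if j \<in> {b..} then \<alpha> ^ j / fact j else 0))"
  using pmf_rho[OF assms] by auto

lemma set_pmf_rho: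
  assumes "\<alpha> > 0"
  shows "set_pmf (rho b \<alpha>) = {b..}"
  using assms Z_pos[OF assms, of b] by (auto simp: set_pmf_iff pmf_rho_eq split: if_splits)

lemma expectation_rho:
  assumes "\<alpha> > 0"
  shows "integrable (rho b \<alpha>) real"
    and "measure_pmf.expectation (rho b \<alpha>) real = \<alpha> + real b * (\<alpha> ^ b / fact b) / Z b \<alpha>"
proof -
  have "(\<lambda>j. pmf (rho b \<alpha>) j * real j) sums (1 / Z b \<alpha> * (\<alpha> * Z b \<alpha> + real b * (\<alpha> ^ b / fact b)))"
    using sums_mult[OF first_moment_sums, of "1 / Z b \<alpha>" b \<alpha>]
    unfolding pmf_rho_eq[OF assms] by (simp only: ac_simps)
  also have "1 / Z b \<alpha> * (\<alpha> * Z b \<alpha> + real b * (\<alpha> ^ b / fact b)) =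
             \<alpha> + real b * (\<alpha> ^ b / fact b) / Z b \<alpha>"
    using Z_pos[OF assms, of b] by (simp add: field_simps)
  finally show "integrable (rho b \<alpha>) real"
    and "measure_pmf.expectation (rho b \<alpha>) real = \<alpha> + real b * (\<alpha> ^ b / fact b) / Z b \<alpha>"
    using nat_pmf_expectation_sums[of real] by auto
qed

lemma integrable_square_rho:
  assumes "\<alpha> > 0"
  shows "integrable (rho b \<alpha>) (\<lambda>j. (real j)\<^sup>2)"
proof -
  have "summable (\<lambda>j. 1 / Z b \<alpha> * ((real j)\<^sup>2 * (if j \<in> {b..} then \<alpha> ^ j / fact j else 0)))"
    by (intro summable_mult second_moment_summable assms)
  then have "summable (\<lambda>j. pmf (rho b \<alpha>) j * (real j)\<^sup>2)"
    unfolding pmf_rho_eq[OF assms] by (simp only: ac_simps)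
  from nat_pmf_expectation_sums(1)[OF _ summable_sums[OF this]] show ?thesis by simp
qed

section \<open>Dependence of the mean on the parameter\<close>

text \<open>As \<open>x^j\<close> increases in \<open>j\<close>, the two factors change sign
  together at \<open>j = c\<close>.\<close>

lemma power_minus_powr_nonneg:
  fixes x c :: real
  assumes "x > 1"
  shows "0 \<le> (real j - c) * (x ^ j - x powr c)" and "real j < c \<Longrightarrow> 0 < (real j - c) * (x ^ j - x powr c)"
proof -
  have x: "x ^ j = x powr real j" using assms by (simp add: powr_realpow)
  show "0 \<le> (real j - c) * (x ^ j - x powr c)"
    unfolding x using assms by (cases "c \<le> real j") (auto intro!: mult_nonneg_nonneg mult_nonpos_nonpos)
  show "0 < (real j - c) * (x ^ j - x powr c)" if "real j < c"
    unfolding x using assms that by (intro mult_neg_neg) auto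
qed

text \<open>
  If the mean is \<open>c\<close> at \<open>\<alpha>\<close> and \<open>x = \<beta> / \<alpha> > 1\<close>, then
  \<open>\<Sum>j\<ge>b. (j - c) \<beta>^j / j! = \<Sum>j\<ge>b. (j - c) (x^j - x^c) \<alpha>^j / j!\<close>, whose terms are
  nonnegative.
\<close>

lemma expectation_rho_strict_mono:
  assumes "0 < \<alpha>" and "\<alpha> < \<beta>" and "real b < measure_pmf.expectation (rho b \<alpha>) real"
  shows "measure_pmf.expectation (rho b \<alpha>) real < measure_pmf.expectation (rho b \<beta>) real"
proof -
  define c where "c = measure_pmf.expectation (rho b \<alpha>) real"
  define x where "x = \<beta> / \<alpha>"
  have x: "x > 1" using assms by (simp add: x_def)
  let ?w = "\<lambda>a j. if j \<in> {b..} then a ^ j / fact j else (0::real)"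
  have centred: "(\<lambda>j. (real j - c) * ?w a j) sums
      ((measure_pmf.expectation (rho b a) real - c) * Z b a)" if "a > 0" for a
  proof -
    have "(\<lambda>j. real j * ?w a j - c * ?w a j) sums
            (a * Z b a + real b * (a ^ b / fact b) - c * Z b a)"
      by (intro sums_diff first_moment_sums sums_mult Z_sums)
    moreover have "a * Z b a + real b * (a ^ b / fact b) - c * Z b a =
        (measure_pmf.expectation (rho b a) real - c) * Z b a"
      using Z_pos[OF that, of b] by (simp add: expectation_rho that field_simps)
    ultimately show ?thesis by (simp only: left_diff_distrib)
  qed
  \<comment> \<open>The series at \<open>\<alpha>\<close>, centred at its own mean \<open>c\<close>,
    sums to \<open>0\<close>, so any multiple of it may be subtracted; the multiple
    \<open>x powr c\<close> makes all terms nonnegative.\<close>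
  have "(\<lambda>j. (real j - c) * ?w \<beta> j - x powr c * ((real j - c) * ?w \<alpha> j)) sums
      ((measure_pmf.expectation (rho b \<beta>) real - c) * Z b \<beta> - x powr c * 0)"
    using centred[of \<alpha>] assms by (intro sums_diff sums_mult centred) (auto simp: c_def)
  moreover have "(real j - c) * ?w \<beta> j - x powr c * ((real j - c) * ?w \<alpha> j) =
      (real j - c) * (x ^ j - x powr c) * ?w \<alpha> j" for j
    using assms by (simp add: x_def field_simps)
  ultimately have sums: "(\<lambda>j. (real j - c) * (x ^ j - x powr c) * ?w \<alpha> j) sums
      ((measure_pmf.expectation (rho b \<beta>) real - c) * Z b \<beta>)"
    by simp
  have "0 < (\<Sum>j. (real j - c) * (x ^ j - x powr c) * ?w \<alpha> j)"
  proof (rule suminf_pos2)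
    show "0 \<le> (real j - c) * (x ^ j - x powr c) * ?w \<alpha> j" for j
      using power_minus_powr_nonneg(1)[OF x, of j c] assms
      by (intro mult_nonneg_nonneg[of "_ * _"]) auto
    \<comment> \<open>\<open>b\<close> lies strictly below the mean, so the term at
      \<open>j = b\<close> makes the inequality strict.\<close>
    show "0 < (real b - c) * (x ^ b - x powr c) * ?w \<alpha> b"
      using power_minus_powr_nonneg(2)[OF x, of b c] assms by (auto simp: c_def)
  qed (use sums in \<open>simp add: sums_iff\<close>)
  then have "0 < (measure_pmf.expectation (rho b \<beta>) real - c) * Z b \<beta>"
    using sums by (simp add: sums_iff)
  then show ?thesis
    using Z_pos[of \<beta> b] assms by (simp add: zero_less_mult_iff c_def)
qed

text \<open>The mean exceeds \<open>\<alpha>\<close> by \<open>b\<close> times the probability of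
  the value \<open>b\<close>, that is, by an amount between \<open>0\<close> and \<open>b\<close>.
  So it is at most \<open>c\<close> at \<open>\<alpha> = c - b\<close> and at least \<open>c\<close>
  at \<open>\<alpha> = c\<close>, and the intermediate value theorem applies.\<close>

lemma expectation_rho_attained:
  assumes "c > real b"
  shows "\<exists>\<alpha>>0. measure_pmf.expectation (rho b \<alpha>) real = c"
proof -
  define g where "g = (\<lambda>\<alpha>. \<alpha> + real b * (\<alpha> ^ b / fact b) / Z b \<alpha>)"
  have pos: "\<alpha> > 0" if "\<alpha> \<ge> c - real b" for \<alpha> using that assms by simp
  have "\<exists>\<alpha>\<ge>c - real b. \<alpha> \<le> c \<and> g \<alpha> = c"
  proof (rule IVT')
    have "(c - real b) ^ b / fact b \<le> Z b (c - real b)"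
    proof -
      have "(\<Sum>j\<in>{b}. if j \<in> {b..} then (c - real b) ^ j / fact j else 0) \<le>
            (\<Sum>j. if j \<in> {b..} then (c - real b) ^ j / fact j else 0)"
        by (rule sum_le_suminf) (use assms Z_sums[of b "c - real b"] in \<open>auto simp: sums_iff\<close>)
      then show ?thesis using Z_sums[of b "c - real b"] by (simp add: sums_iff)
    qed
    then have "(c - real b) ^ b / fact b / Z b (c - real b) \<le> 1"
      using Z_pos[of "c - real b" b] assms by (simp only: divide_le_eq_1) simp
    from mult_left_mono[OF this, of "real b"] show "g (c - real b) \<le> c"
      by (simp add: g_def)
    show "c \<le> g c"
      using assms Z_pos[of c b] by (simp add: g_def)
    have "Z b \<alpha> \<noteq> 0" if "\<alpha> \<ge> c - real b" for \<alpha>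
      using Z_pos[OF pos[OF that], of b] by simp
    then show "continuous_on {c - real b..c} g"
      unfolding g_def Z_def by (intro continuous_intros) auto
  qed simp
  then show ?thesis
    using pos expectation_rho(2) unfolding g_def by metis
qed

text \<open>Existence and strict monotonicity make the definite description in \<open>alpha\<close>
  well defined.\<close>

lemma alpha:
  assumes "c > real b"
  shows "alpha b c > 0" and "measure_pmf.expectation (rho b (alpha b c)) real = c"
proof -
  have "\<exists>!\<alpha>. \<alpha> > 0 \<and> measure_pmf.expectation (rho b \<alpha>) real = c"
  proof (rule ex_ex1I)
    fix \<alpha> \<beta>
    assume "0 < \<alpha> \<and> measure_pmf.expectation (rho b \<alpha>) real = c"
      "0 < \<beta> \<and> measure_pmf.expectation (rho b \<beta>) real = c"
    then show "\<alpha> = \<beta>"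
      using expectation_rho_strict_mono[of \<alpha> \<beta> b] expectation_rho_strict_mono[of \<beta> \<alpha> b] assms
      by (cases \<alpha> \<beta> rule: linorder_cases) auto
  qed (use expectation_rho_attained[OF assms] in auto)
  from theI'[OF this] show "alpha b c > 0"
    and "measure_pmf.expectation (rho b (alpha b c)) real = c"
    by (auto simp: alpha_def)
qed

section \<open>Configurations with a given occupation profile\<close>

text \<open>The constraints are put in terms of occupation numbers alone, so that the same set
  serves as an event under a product measure. The cardinality of the image is the number of occupied
  levels; values off \<open>{1..N}\<close> are left free.\<close>

definition occupation_profiles :: "nat \<Rightarrow> nat \<Rightarrow> nat \<Rightarrow> nat \<Rightarrow> (nat \<Rightarrow> nat) set" where
  "occupation_profiles N K b M =
     {k. (\<Sum>l\<in>{1..N}. k l) = K \<and> (\<forall>l\<in>{1..N}. b \<le> k l) \<and> card (k ` {1..N}) \<le> M}"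

lemma finite_configs: "finite (configs N K)"
  by (simp add: configs_def finite_PiE)

lemma occupation_eq_0:
  assumes "\<omega> \<in> configs N K" "l \<notin> {1..N}"
  shows "occupation K \<omega> l = 0"
  using assms by (auto simp: occupation_def configs_def PiE_iff)

lemma sum_occupation:
  assumes "\<omega> \<in> configs N K"
  shows "(\<Sum>l\<in>{1..N}. occupation K \<omega> l) = K"
proof -
  have "(\<Sum>l\<in>{1..N}. occupation K \<omega> l) = card (\<Union>l\<in>{1..N}. {i \<in> {1..K}. \<omega> i = l})"
    unfolding occupation_def by (subst card_UN_disjoint) auto
  also have "(\<Union>l\<in>{1..N}. {i \<in> {1..K}. \<omega> i = l}) = {1..K}"
    using assms by (auto simp: configs_def PiE_iff)
  finally show ?thesis by simp
qed

text \<open>A level is occupied exactly if it is a value of the occupation map on the sites; once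
  these values are all at least \<open>b\<close>, restricting the levels to \<open>{b..}\<close>
  loses none.\<close>

lemma restricted_configs_iff:
  assumes "\<omega> \<in> configs N K"
  shows "\<omega> \<in> restricted_configs N K b M \<longleftrightarrow> occupation K \<omega> \<in> occupation_profiles N K b M"
proof -
  have "num_levels N K b \<omega> = card (occupation K \<omega> ` {1..N})"
    if "\<forall>l\<in>{1..N}. b \<le> occupation K \<omega> l"
  proof -
    have "num_sites N K \<omega> j \<ge> 1 \<longleftrightarrow> j \<in> occupation K \<omega> ` {1..N}" for j
      by (auto simp: num_sites_def Suc_le_eq card_gt_0_iff)
    then have "{j \<in> {b..}. num_sites N K \<omega> j \<ge> 1} = occupation K \<omega> ` {1..N}"
      using that by blast
    then show ?thesis by (simp add: num_levels_def)
  qed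
  then show ?thesis
    unfolding restricted_configs_def occupation_profiles_def mem_Collect_eq
    using assms sum_occupation[OF assms] by metis
qed

text \<open>Written as the list of its values, a configuration in the fibre is an arrangement of the
  multiset that contains site \<open>l\<close> with multiplicity \<open>k l\<close>; the count is a
  multinomial coefficient.\<close>

lemma card_occupation_fibre:
  assumes zero: "\<And>l. l \<notin> {1..N} \<Longrightarrow> k l = 0" and sum: "(\<Sum>l\<in>{1..N}. k l) = K"
  shows "card {\<omega> \<in> configs N K. occupation K \<omega> = k} * (\<Prod>l\<in>{1..N}. fact (k l)) = fact K"
proof -
  define A where "A = Abs_multiset k"
  have pos: "l \<in> {1..N}" if "k l > 0" for l
    using zero[of l] that by (cases "l \<in> {1..N}") auto
  then have "{l. k l > 0} \<subseteq> {1..N}" by blast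
  then have "finite {l. k l > 0}" by (rule finite_subset) simp
  then have count: "count A = k"
    by (simp add: A_def)
  have set: "set_mset A \<subseteq> {1..N}"
    using pos by (intro subsetI) (simp only: count flip: count_greater_zero_iff)
  have "size A = (\<Sum>l\<in>{1..N}. count A l)"
    unfolding size_multiset_overloaded_eq
    by (rule sum.mono_neutral_left) (use set in \<open>auto simp: not_in_iff\<close>)
  then have size: "size A = K" by (simp only: count sum)
  have mset: "mset (map \<omega> [1..<Suc K]) = A \<longleftrightarrow> occupation K \<omega> = k" for \<omega>
  proof -
    have "count (mset (map \<omega> [1..<Suc K])) = occupation K \<omega>"
    proof
      fix l
      have "count (mset (map \<omega> [1..<Suc K])) l = length (filter (\<lambda>i. l = \<omega> i) [1..<Suc K])"
        by (simp only: count_mset count_list_eq_length_filter filter_map o_def length_map)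
      also have "\<dots> = card (set (filter (\<lambda>i. l = \<omega> i) [1..<Suc K]))"
        by (rule distinct_card[symmetric]) simp
      also have "set (filter (\<lambda>i. l = \<omega> i) [1..<Suc K]) = {i \<in> {1..K}. \<omega> i = l}"
        by auto
      finally show "count (mset (map \<omega> [1..<Suc K])) l = occupation K \<omega> l"
        by (simp add: occupation_def)
    qed
    then show ?thesis by (metis count count_inject)
  qed
  have "bij_betw (\<lambda>\<omega>. map \<omega> [1..<Suc K]) {\<omega> \<in> configs N K. occupation K \<omega> = k}
          (permutations_of_multiset A)"
  proof (rule bij_betw_imageI)
    show "inj_on (\<lambda>\<omega>. map \<omega> [1..<Suc K]) {\<omega> \<in> configs N K. occupation K \<omega> = k}"
      by (rule inj_onI, rule PiE_ext[of _ "{1..K}" "\<lambda>_. {1..N}"])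
         (auto simp: configs_def simp del: upt_Suc)
    show "(\<lambda>\<omega>. map \<omega> [1..<Suc K]) ` {\<omega> \<in> configs N K. occupation K \<omega> = k} =
            permutations_of_multiset A"
    proof (intro equalityI subsetI)
      fix xs assume "xs \<in> permutations_of_multiset A"
      then have xs: "mset xs = A" by (simp add: permutations_of_multiset_def)
      then have len: "length xs = K" and sub: "set xs \<subseteq> {1..N}"
        using size set by (metis size_mset, metis set_mset_mset)
      \<comment> \<open>Particle \<open>i\<close> reads list position \<open>i - 1\<close>; outside
        \<open>{1..K}\<close> the value must be \<open>undefined\<close>, as membership in
        \<open>configs\<close> demands.\<close>
      define \<omega> where "\<omega> = restrict (\<lambda>i. xs ! (i - 1)) {1..K}"
      have map: "map \<omega> [1..<Suc K] = xs"
        by (rule nth_equalityI) (auto simp: \<omega>_def len simp del: upt_Suc)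
      have "\<omega> \<in> configs N K"
        unfolding configs_def \<omega>_def restrict_PiE_iff
      proof
        fix i assume "i \<in> {1..K}"
        then have "xs ! (i - 1) \<in> set xs" by (intro nth_mem) (auto simp: len)
        then show "xs ! (i - 1) \<in> {1..N}" using sub by blast
      qed
      moreover have "occupation K \<omega> = k"
        using mset[of \<omega>] map xs by blast
      ultimately show "xs \<in> (\<lambda>\<omega>. map \<omega> [1..<Suc K]) ` {\<omega> \<in> configs N K. occupation K \<omega> = k}"
        by (subst map[symmetric]) (rule imageI, simp)
    next
      fix xs assume "xs \<in> (\<lambda>\<omega>. map \<omega> [1..<Suc K]) ` {\<omega> \<in> configs N K. occupation K \<omega> = k}"
      then show "xs \<in> permutations_of_multiset A"
        unfolding permutations_of_multiset_def using mset by blast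
    qed
  qed
  then have "card {\<omega> \<in> configs N K. occupation K \<omega> = k} = card (permutations_of_multiset A)"
    by (rule bij_betw_same_card)
  moreover have "(\<Prod>l\<in>{1..N}. fact (k l)) = (\<Prod>l\<in>set_mset A. fact (count A l) :: nat)"
    using set by (intro prod.mono_neutral_cong_right) (auto simp: count not_in_iff)
  ultimately show ?thesis
    using card_permutations_of_multiset_aux[of A] size by simp
qed

text \<open>
  The multinomial weight \<open>K! / \<Prod>l. k l!\<close> of an occupation profile is, up to a factor depending on
  \<open>N\<close> and \<open>K\<close> only, its probability under independent truncated Poisson occupation numbers.
\<close>

lemma card_restricted_configs_conv_Pi_pmf:
  assumes "\<alpha> > 0" and rho: "\<And>j. pmf p j = (if j \<in> {b..} then 1 / Z b \<alpha> * (\<alpha> ^ j / fact j) else 0)"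
  shows "real (card {\<omega> \<in> restricted_configs N K b M. occupation K \<omega> \<in> E}) =
    fact K * Z b \<alpha> ^ N / \<alpha> ^ K *
      measure_pmf.prob (Pi_pmf {1..N} 0 (\<lambda>_. p)) (occupation_profiles N K b M \<inter> E)"
proof -
  define S where "S = {\<omega> \<in> restricted_configs N K b M. occupation K \<omega> \<in> E}"
  define Q where "Q = Pi_pmf {1..N} 0 (\<lambda>_. p)"
  have Z: "Z b \<alpha> > 0" by (rule Z_pos) fact
  have sub: "S \<subseteq> configs N K" by (auto simp: S_def restricted_configs_def)
  then have fin: "finite S" using finite_configs finite_subset by blast
  have fibre: "real (card {\<omega> \<in> S. occupation K \<omega> = k}) = fact K * Z b \<alpha> ^ N / \<alpha> ^ K * pmf Q k"
    if k: "k \<in> occupation K ` S" for k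
  proof -
    have prof: "k \<in> occupation_profiles N K b M" and zero: "\<And>l. l \<notin> {1..N} \<Longrightarrow> k l = 0"
      using k sub restricted_configs_iff by (auto simp: S_def intro: occupation_eq_0)
    then have sum: "(\<Sum>l\<in>{1..N}. k l) = K" and ge: "\<And>l. l \<in> {1..N} \<Longrightarrow> b \<le> k l"
      by (auto simp: occupation_profiles_def)
    have "{\<omega> \<in> S. occupation K \<omega> = k} = {\<omega> \<in> configs N K. occupation K \<omega> = k}"
      using k sub prof restricted_configs_iff by (auto simp: S_def)
    then have "real (card {\<omega> \<in> S. occupation K \<omega> = k}) * (\<Prod>l\<in>{1..N}. fact (k l)) = fact K"
      using arg_cong[OF card_occupation_fibre[OF zero sum], of real] by simp
    then have "real (card {\<omega> \<in> S. occupation K \<omega> = k}) = fact K / (\<Prod>l\<in>{1..N}. fact (k l))"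
      by (simp add: field_simps)
    moreover have "pmf Q k = \<alpha> ^ K / Z b \<alpha> ^ N / (\<Prod>l\<in>{1..N}. fact (k l))"
    proof -
      have "pmf Q k = (\<Prod>l\<in>{1..N}. 1 / Z b \<alpha> * (\<alpha> ^ k l / fact (k l)))"
        unfolding Q_def using zero ge by (subst pmf_Pi') (auto simp: rho intro!: prod.cong)
      \<comment> \<open>The exponents sum to \<open>K\<close>, so apart from the factorials nothing
        depends on the profile.\<close>
      also have "\<dots> = \<alpha> ^ K / Z b \<alpha> ^ N / (\<Prod>l\<in>{1..N}. fact (k l))"
        using sum by (simp add: prod.distrib prod_dividef power_divide flip: power_sum)
      finally show ?thesis .
    qed
    ultimately show ?thesis using Z assms(1) by simp
  qed
  \<comment> \<open>Profiles that are nonzero off the sites have probability zero; on the support of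
    \<open>Q\<close> the event reduces to the image of \<open>S\<close>, which is finite.\<close>
  have "occupation_profiles N K b M \<inter> E \<inter> set_pmf Q = occupation K ` S \<inter> set_pmf Q"
  proof (intro equalityI subsetI)
    fix k assume k: "k \<in> occupation_profiles N K b M \<inter> E \<inter> set_pmf Q"
    then have "\<And>l. l \<notin> {1..N} \<Longrightarrow> k l = 0"
      using set_Pi_pmf_subset[of "{1..N}" 0 "\<lambda>_. p"] unfolding Q_def by blast
    moreover have "(\<Sum>l\<in>{1..N}. k l) = K" using k by (simp add: occupation_profiles_def)
    \<comment> \<open>The fibre is nonempty because its size is a factor of \<open>fact K\<close>,
      which is nonzero.\<close>
    ultimately have "card {\<omega> \<in> configs N K. occupation K \<omega> = k} \<noteq> 0"
      using card_occupation_fibre[of N k K] by (metis fact_nonzero mult_zero_left)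
    then obtain \<omega> where "\<omega> \<in> configs N K" "occupation K \<omega> = k"
      by (metis (mono_tags, lifting) card.empty empty_Collect_eq)
    then show "k \<in> occupation K ` S \<inter> set_pmf Q"
      using k restricted_configs_iff[of \<omega> N K b M] by (auto simp: S_def)
  qed (use sub restricted_configs_iff in \<open>auto simp: S_def\<close>)
  then have "measure_pmf.prob Q (occupation_profiles N K b M \<inter> E) =
      measure_pmf.prob Q (occupation K ` S)"
    by (metis measure_Int_set_pmf)
  moreover have "real (card S) = (\<Sum>k\<in>occupation K ` S. real (card {\<omega> \<in> S. occupation K \<omega> = k}))"
    using sum.image_gen[OF fin, of "\<lambda>_. 1::real" "occupation K"] by simp
  moreover have "\<dots> = fact K * Z b \<alpha> ^ N / \<alpha> ^ K * measure_pmf.prob Q (occupation K ` S)"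
    using fin by (simp add: fibre measure_measure_pmf_finite sum_distrib_left)
  ultimately show ?thesis by (simp add: S_def Q_def)
qed

section \<open>Sums of independent occupation numbers\<close>

text \<open>The set \<open>V\<close> of allowed levels is a parameter so that one finite set of
  levels can be imposed on all blocks at once; \<open>UNIV\<close> imposes nothing.\<close>

definition iid_weight :: "nat pmf \<Rightarrow> nat set \<Rightarrow> nat \<Rightarrow> nat \<Rightarrow> real" where
  "iid_weight p V n t =
     measure_pmf.prob (Pi_pmf {..<n} 0 (\<lambda>_. p)) {k. sum k {..<n} = t \<and> k ` {..<n} \<subseteq> V}"

section \<open>Supermultiplicativity of the weights\<close>

lemma iid_weight_nonneg: "0 \<le> iid_weight p V n t"
  by (simp add: iid_weight_def)

text \<open>The law is invariant under relabelling the sites, so only their number matters.\<close>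

lemma iid_weight_index_set:
  assumes "finite I" and "card I = n"
  shows "measure_pmf.prob (Pi_pmf I 0 (\<lambda>_. p)) {k. sum k I = t \<and> k ` I \<subseteq> V} = iid_weight p V n t"
proof -
  obtain h where h: "bij_betw h I {..<n}"
    using assms finite_same_card_bij[of I "{..<n}"] by auto
  \<comment> \<open>Points outside \<open>I\<close> must be sent outside \<open>{..<n}\<close>, so
    that they receive the default value of the product measure; \<open>n\<close> is such a
    point.\<close>
  define h' where "h' = (\<lambda>x. if x \<in> I then h x else n)"
  have h': "bij_betw h' I {..<n}"
    using h by (rule bij_betw_cong[THEN iffD1, rotated]) (simp add: h'_def)
  have "Pi_pmf I 0 (\<lambda>_. p) = map_pmf (\<lambda>g. g \<circ> h') (Pi_pmf {..<n} 0 (\<lambda>_. p))"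
    by (rule Pi_pmf_bij_betw[OF assms(1) h']) (simp add: h'_def)
  moreover have "sum (g \<circ> h') I = sum g {..<n}" for g :: "nat \<Rightarrow> nat"
    using sum.reindex_bij_betw[OF h', of g] by (simp add: o_def)
  moreover have "(g \<circ> h') ` I = g ` {..<n}" for g :: "nat \<Rightarrow> nat"
    using bij_betw_imp_surj_on[OF h'] by (simp flip: image_image add: o_def image_image[symmetric])
  ultimately show ?thesis
    by (simp add: iid_weight_def vimage_def del: o_apply)
qed

text \<open>Intersecting with the supports, which are countable, reduces arbitrary events, such as
  sets of functions, to countable ones, for which the product rule is applied.\<close>

lemma prob_pair_pmf_Times:
  "measure_pmf.prob (pair_pmf p q) (A \<times> B) = measure_pmf.prob p A * measure_pmf.prob q B"
proof -
  have "measure_pmf.prob (pair_pmf p q) (A \<times> B) =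
      measure_pmf.prob (pair_pmf p q) ((A \<inter> set_pmf p) \<times> (B \<inter> set_pmf q))"
    by (subst measure_Int_set_pmf[symmetric], rule arg_cong[where f = "measure _"]) auto
  also have "\<dots> = measure_pmf.prob p (A \<inter> set_pmf p) * measure_pmf.prob q (B \<inter> set_pmf q)"
    by (rule measure_pmf_prob_product) (auto intro: countable_subset[OF _ countable_set_pmf])
  finally show ?thesis by (simp only: measure_Int_set_pmf)
qed

text \<open>Two independent blocks with sums \<open>t\<close> and \<open>t'\<close> are glued to one
  with sum \<open>t + t'\<close>. Only an inequality results, since the total may split in other
  ways.\<close>

lemma iid_weight_add:
  "iid_weight p V n t * iid_weight p V n' t' \<le> iid_weight p V (n + n') (t + t')"
proof -
  define A B where "A = {..<n}" and "B = {n..<n + n'}"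
  define glue where "glue = (\<lambda>(f, g) x. if x \<in> A then f x else g x :: nat)"
  define E :: "nat set \<Rightarrow> nat \<Rightarrow> (nat \<Rightarrow> nat) set" where "E I t = {k. sum k I = t \<and> k ` I \<subseteq> V}" for I t
  have fin: "finite A" "finite B" and disj: "A \<inter> B = {}" by (auto simp: A_def B_def)
  have "iid_weight p V n t * iid_weight p V n' t' =
      measure_pmf.prob (pair_pmf (Pi_pmf A 0 (\<lambda>_. p)) (Pi_pmf B 0 (\<lambda>_. p))) (E A t \<times> E B t')"
    using iid_weight_index_set[of A n p t V] iid_weight_index_set[of B n' p t' V] fin
    by (simp add: prob_pair_pmf_Times E_def A_def B_def)
  also have "\<dots> \<le> measure_pmf.prob (pair_pmf (Pi_pmf A 0 (\<lambda>_. p)) (Pi_pmf B 0 (\<lambda>_. p)))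
      (glue -` E (A \<union> B) (t + t'))"
  proof (rule measure_pmf.finite_measure_mono)
    have "glue (f, g) \<in> E (A \<union> B) (t + t')" if "f \<in> E A t" "g \<in> E B t'" for f g
    proof -
      have "sum (glue (f, g)) A = sum f A" "sum (glue (f, g)) B = sum g B"
        using disj by (auto simp: glue_def intro!: sum.cong)
      then show ?thesis
        using that fin disj by (auto simp: E_def sum.union_disjoint glue_def)
    qed
    then show "E A t \<times> E B t' \<subseteq> glue -` E (A \<union> B) (t + t')" by auto
  qed simp
  also have "\<dots> = measure_pmf.prob (Pi_pmf (A \<union> B) 0 (\<lambda>_. p)) (E (A \<union> B) (t + t'))"
    unfolding glue_def by (subst Pi_pmf_union[OF fin disj]) simp
  also have "\<dots> = iid_weight p V (n + n') (t + t')"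
    unfolding E_def by (rule iid_weight_index_set) (auto simp: A_def B_def ivl_disj_un)
  finally show ?thesis .
qed

lemma iid_weight_0 [simp]: "iid_weight p V 0 0 = 1"
  by (simp add: iid_weight_def)

lemma iid_weight_1:
  assumes "x \<in> V"
  shows "iid_weight p V (Suc 0) x = pmf p x"
proof -
  have "iid_weight p V (Suc 0) x =
      measure_pmf.prob (map_pmf (\<lambda>k. k 0) (Pi_pmf {0::nat} 0 (\<lambda>_. p))) {x}"
    using assms by (auto simp: iid_weight_def vimage_def lessThan_Suc intro!: arg_cong[where f = "measure _"])
  also have "\<dots> = pmf p x" by (subst Pi_pmf_component) (auto simp: pmf.rep_eq)
  finally show ?thesis .
qed

lemma iid_weight_mult:
  "iid_weight p V n t ^ q \<le> iid_weight p V (q * n) (q * t)"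
proof (induction q)
  case (Suc q)
  have "iid_weight p V n t * iid_weight p V n t ^ q \<le>
      iid_weight p V n t * iid_weight p V (q * n) (q * t)"
    by (intro mult_left_mono Suc.IH iid_weight_nonneg)
  also have "\<dots> \<le> iid_weight p V (n + q * n) (t + q * t)" by (rule iid_weight_add)
  finally show ?case by simp
qed simp

text \<open>A crude bound from a single explicit profile: a total between \<open>b n\<close> and
  \<open>B n\<close> can be filled site by site with levels in \<open>{b..B}\<close>, each costing a
  factor of at least \<open>\<eta>\<close>.\<close>

lemma iid_weight_ge_power:
  assumes "\<And>x. x \<in> {b..B} \<Longrightarrow> x \<in> V \<and> \<eta> \<le> pmf p x" and "0 \<le> \<eta>"
    and "b * n \<le> t" "t \<le> B * n" "b \<le> B"
  shows "\<eta> ^ n \<le> iid_weight p V n t"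
  using assms(3,4)
proof (induction n arbitrary: t)
  case (Suc n)
  \<comment> \<open>If the other \<open>n\<close> sites can be filled with \<open>B\<close> each and
    still leave at least \<open>b\<close>, the current site takes the rest; otherwise it takes
    \<open>b\<close>.\<close>
  have "\<exists>x\<in>{b..B}. x \<le> t \<and> b * n \<le> t - x \<and> t - x \<le> B * n"
  proof (cases "b + B * n \<le> t")
    case True
    then show ?thesis
      using Suc.prems \<open>b \<le> B\<close> mult_le_mono1[OF \<open>b \<le> B\<close>, of n]
      by (intro bexI[of _ "t - B * n"]) auto
  next
    case False
    then show ?thesis
      using Suc.prems \<open>b \<le> B\<close> by (intro bexI[of _ b]) auto
  qed
  then obtain x where x: "x \<in> {b..B}" "x \<le> t" "b * n \<le> t - x" "t - x \<le> B * n" by blast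
  have "\<eta> * \<eta> ^ n \<le> iid_weight p V (Suc 0) x * iid_weight p V n (t - x)"
    using assms(1,2) x by (intro mult_mono Suc.IH) (auto simp: iid_weight_1 iid_weight_nonneg)
  also have "\<dots> \<le> iid_weight p V (Suc 0 + n) (x + (t - x))" by (rule iid_weight_add)
  finally show ?case using x by simp
qed simp

section \<open>Subexponential lower bounds for the weights\<close>

text \<open>Chebyshev's inequality; the variance is additive because the cross terms of the centred
  variables vanish by independence.\<close>

lemma iid_sum_deviation:
  fixes p :: "nat pmf"
  assumes int: "integrable p (\<lambda>j. (real j)\<^sup>2)" and "a > 0"
  defines "c \<equiv> measure_pmf.expectation p real"
  shows "measure_pmf.prob (Pi_pmf {..<n} 0 (\<lambda>_. p)) {k. \<bar>real (sum k {..<n}) - c * real n\<bar> \<ge> a}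
           \<le> real n * measure_pmf.expectation p (\<lambda>j. (real j - c)\<^sup>2) / a\<^sup>2"
proof -
  define Q where "Q = Pi_pmf {..<n} 0 (\<lambda>_. p)"
  define v where "v = measure_pmf.expectation p (\<lambda>j. (real j - c)\<^sup>2)"
  define Y where "Y = (\<lambda>i (k :: nat \<Rightarrow> nat). real (k i) - c)"
  have int1: "integrable p real"
    by (rule measure_pmf.square_integrable_imp_integrable[OF _ int]) simp
  have comp: "p = map_pmf (\<lambda>k. k i) Q" if "i < n" for i
    using that unfolding Q_def by (subst Pi_pmf_component) auto
  have integrable_comp: "integrable Q (\<lambda>k. f (k i)) \<longleftrightarrow> integrable p f"
    and expectation_comp: "measure_pmf.expectation Q (\<lambda>k. f (k i)) = measure_pmf.expectation p f"
    if "i < n" for i and f :: "nat \<Rightarrow> real"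
    by (subst comp[OF that], simp)+
  have intsq: "integrable p (\<lambda>j. (real j - c)\<^sup>2)"
    using int int1 by (simp add: power2_diff)
  have intY: "integrable Q (Y i)" and expY: "measure_pmf.expectation Q (Y i) = 0"
    if "i < n" for i
    using that int1 integrable_comp[of i "\<lambda>j. real j - c"] expectation_comp[of i "\<lambda>j. real j - c"]
    by (auto simp: Y_def c_def)
  have indep: "prob_space.indep_vars Q (\<lambda>_. borel) Y {..<n}"
    unfolding Y_def Q_def
    by (intro prob_space.indep_vars_compose2[OF _ indep_vars_Pi_pmf])
       (auto simp: measure_pmf.prob_space_axioms)
  have cross: "integrable Q (\<lambda>k. Y i k * Y j k)"
    "measure_pmf.expectation Q (\<lambda>k. Y i k * Y j k) = (if i = j then v else 0)"
    if ij: "i < n" "j < n" for i j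
  proof -
    have "integrable Q (\<lambda>k. Y i k * Y j k) \<and>
      measure_pmf.expectation Q (\<lambda>k. Y i k * Y j k) = (if i = j then v else 0)"
    proof (cases "i = j")
      case True
      then show ?thesis
        using ij intsq integrable_comp[of i "\<lambda>j. (real j - c)\<^sup>2"]
          expectation_comp[of i "\<lambda>j. (real j - c)\<^sup>2"]
        by (simp add: Y_def v_def power2_eq_square)
    next
      case False
      have "prob_space.indep_vars Q (\<lambda>_. borel) Y {i, j}"
        by (rule prob_space.indep_vars_subset[OF measure_pmf.prob_space_axioms indep]) (use ij in auto)
      from prob_space.indep_vars_lebesgue_integral[OF measure_pmf.prob_space_axioms _ this]
        prob_space.indep_vars_integrable[OF measure_pmf.prob_space_axioms _ this]
      show ?thesis using False ij intY expY by auto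
    qed
    then show "integrable Q (\<lambda>k. Y i k * Y j k)"
      "measure_pmf.expectation Q (\<lambda>k. Y i k * Y j k) = (if i = j then v else 0)" by auto
  qed
  define S where "S = (\<lambda>k. \<Sum>i<n. Y i k)"
  have S: "S k = real (sum k {..<n}) - c * real n" for k
    by (simp add: S_def Y_def sum_subtractf)
  have sq: "(S k)\<^sup>2 = (\<Sum>i<n. \<Sum>j<n. Y i k * Y j k)" for k
    by (simp add: S_def power2_eq_square sum_product)
  have "integrable Q (\<lambda>k. (S k)\<^sup>2)"
    unfolding sq by (intro Bochner_Integration.integrable_sum cross) auto
  moreover have "measure_pmf.expectation Q (\<lambda>k. (S k)\<^sup>2) = real n * v"
  proof -
    have "measure_pmf.expectation Q (\<lambda>k. (S k)\<^sup>2) =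
        (\<Sum>i<n. \<Sum>j<n. measure_pmf.expectation Q (\<lambda>k. Y i k * Y j k))"
      unfolding sq
      by (subst Bochner_Integration.integral_sum)
         (auto intro!: sum.cong Bochner_Integration.integral_sum Bochner_Integration.integrable_sum cross)
    also have "\<dots> = (\<Sum>i<n. \<Sum>j<n. if i = j then v else 0)"
      by (intro sum.cong cross refl) auto
    finally show ?thesis by simp
  qed
  ultimately show ?thesis
    using measure_pmf.second_moment_method[of S Q a] \<open>a > 0\<close>
    by (simp add: S Q_def v_def)
qed

text \<open>Pigeonhole: at most \<open>T + 1\<close> values share a mass of \<open>1 / 2\<close>.
  The constant \<open>4\<close> leaves slack, since otherwise the mass would be at most
  \<open>1 / 4\<close>.\<close>

lemma exists_likely_sum:
  assumes "1 / 2 \<le> measure_pmf.prob (Pi_pmf {..<n} 0 (\<lambda>_. p)) {k. sum k {..<n} \<in> S}" and "S \<subseteq> {..T}"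
  shows "\<exists>s\<in>S. 1 / (4 * real (T + 1)) \<le> iid_weight p UNIV n s"
proof (rule ccontr)
  assume *: "\<not> ?thesis"
  have fin: "finite S" using assms(2) finite_subset by blast
  have "{k. sum k {..<n} \<in> S} = (\<Union>s\<in>S. {k. sum k {..<n} = s})" by auto
  then have "measure_pmf.prob (Pi_pmf {..<n} 0 (\<lambda>_. p)) {k. sum k {..<n} \<in> S} =
      (\<Sum>s\<in>S. iid_weight p UNIV n s)"
    unfolding iid_weight_def using fin
    by (simp only:, subst measure_pmf.finite_measure_finite_Union) (auto simp: disjoint_family_on_def)
  also have "\<dots> \<le> real (card S) * (1 / (4 * real (T + 1)))"
    using * by (intro sum_bounded_above) auto
  also have "\<dots> \<le> real (T + 1) * (1 / (4 * real (T + 1)))"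
    using card_mono[OF _ assms(2)] by (intro mult_right_mono) auto
  also have "\<dots> < 1 / 2" by (simp add: divide_simps)
  finally show False using assms(1) by simp
qed

text \<open>
  By Chebyshev's inequality and the pigeonhole principle some value close to \<open>c R r\<close> has a
  polynomially small probability of being the sum over \<open>R r\<close> sites. The sum is then corrected to
  \<open>c (R + 1) r\<close> on \<open>r\<close> further sites, at a cost exponential in \<open>r\<close>, which is negligible for large \<open>R\<close>.
\<close>

lemma iid_weight_subexponential:
  fixes p :: "nat pmf"
  assumes int: "integrable p (\<lambda>j. (real j)\<^sup>2)" and mean: "measure_pmf.expectation p real = c"
    and supp: "set_pmf p = {b..}" and c: "c > real b" "c \<in> \<rat>" and "\<delta> > 0"
  shows "\<exists>n t. n > 0 \<and> real t = c * real n \<and> exp (- \<delta> * real n) \<le> iid_weight p UNIV n t"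
proof -
  define v where "v = measure_pmf.expectation p (\<lambda>j. (real j - c)\<^sup>2)"
  \<comment> \<open>The \<open>r\<close> further sites must hold \<open>c r\<close> particles up to
    a correction smaller than \<open>\<kappa> r = (c - b) r\<close>, an average between
    \<open>b\<close> and \<open>2 c - b\<close> per site; \<open>B\<close> covers this
    range.\<close>
  define B where "B = nat \<lceil>2 * c - real b\<rceil>"
  define \<kappa> where "\<kappa> = c - real b"
  define \<eta> where "\<eta> = Min (pmf p ` {b..B})"
  have \<kappa>: "\<kappa> > 0" using c by (simp add: \<kappa>_def)
  have B: "2 * c - real b \<le> real B" "b \<le> B"
    unfolding B_def using c by linarith+
  have \<eta>_pos: "\<eta> > 0" and \<eta>_le: "\<And>x. x \<in> {b..B} \<Longrightarrow> \<eta> \<le> pmf p x"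
    unfolding \<eta>_def using B supp by (auto simp: pmf_positive_iff)
  obtain d e :: nat where d: "d > 0" and e: "c = real e / real d"
  proof -
    from c(2) obtain m n where "n \<noteq> 0" "\<bar>c\<bar> = real m / real n" by (rule Rats_abs_nat_div_natE)
    then show ?thesis using c(1) that[of n m] by simp
  qed
  \<comment> \<open>With \<open>R\<close> this large, the cost \<open>\<eta>^r\<close> of the
    correction takes at most half of the exponent allotted to \<open>(R + 1) r\<close>
    sites.\<close>
  obtain R :: nat where "2 * - ln \<eta> / \<delta> < real R" using reals_Archimedean2 by blast
  then have R: "- ln \<eta> \<le> \<delta> / 2 * (real R + 1)"
    using \<open>\<delta> > 0\<close> by (simp add: field_simps)
  define R' where "R' = real R + 1"
  have R': "R' > 0" by (simp add: R'_def)
  have c0: "c > 0" using c by simp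
  \<comment> \<open>Two demands on \<open>r\<close> at fixed \<open>R\<close>: the pigeonhole factor
    \<open>4 (T + 1)\<close> fits into the other half of the exponent, and Chebyshev's bound drops
    below \<open>1 / 2\<close>.\<close>
  have "eventually (\<lambda>r :: nat. 4 * (c * R' * real r + 1) \<le> exp (\<delta> / 2 * R' * real r)) sequentially"
    using \<open>\<delta> > 0\<close> R' c0 by real_asymp
  moreover have "eventually (\<lambda>r :: nat. real R * v / (\<kappa>\<^sup>2 * real r) < 1 / 2) sequentially"
  proof -
    have "((\<lambda>r :: nat. real R * v / \<kappa>\<^sup>2 * (1 / real r)) \<longlongrightarrow> real R * v / \<kappa>\<^sup>2 * 0) sequentially"
      by (intro tendsto_intros lim_1_over_n)
    then show ?thesis by (intro order_tendstoD(2)[where y = 0]) simp_all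
  qed
  ultimately have "eventually (\<lambda>r :: nat. 4 * (c * R' * real r + 1) \<le> exp (\<delta> / 2 * R' * real r) \<and>
      real R * v / (\<kappa>\<^sup>2 * real r) < 1 / 2) sequentially"
    by (rule eventually_conj)
  then obtain r0 where r0: "\<And>r. r \<ge> r0 \<Longrightarrow>
      4 * (c * R' * real r + 1) \<le> exp (\<delta> / 2 * R' * real r) \<and> real R * v / (\<kappa>\<^sup>2 * real r) < 1 / 2"
    unfolding eventually_sequentially by blast
  \<comment> \<open>A multiple of the denominator \<open>d\<close> of \<open>c\<close>, so that the
    target total \<open>T = c (R + 1) r\<close> is an integer.\<close>
  define r where "r = d * (r0 + 1)"
  define n where "n = R * r"
  define T where "T = e * (R + 1) * (r0 + 1)"
  have "r \<ge> r0" "r > 0" using d mult_le_mono1[of 1 d "r0 + 1"] by (auto simp: r_def)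
  note r = this r0[OF this(1)]
  have T: "real T = c * (R' * real r)"
    using d by (simp add: T_def r_def R'_def e field_simps)
  have "measure_pmf.prob (Pi_pmf {..<n} 0 (\<lambda>_. p)) {k. \<bar>real (sum k {..<n}) - c * real n\<bar> \<ge> \<kappa> * real r}
      \<le> real n * v / (\<kappa> * real r)\<^sup>2"
    unfolding v_def using iid_sum_deviation[OF int, of "\<kappa> * real r" n] \<kappa> r by (simp add: mean)
  also have "\<dots> = real R * v / (\<kappa>\<^sup>2 * real r)"
    using r \<kappa> by (simp add: n_def power2_eq_square field_simps)
  also have "\<dots> < 1 / 2" using r by simp
  finally have dev: "measure_pmf.prob (Pi_pmf {..<n} 0 (\<lambda>_. p))
      {k. \<bar>real (sum k {..<n}) - c * real n\<bar> \<ge> \<kappa> * real r} < 1 / 2" .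
  define S where "S = {s. \<bar>real s - c * real n\<bar> < \<kappa> * real r}"
  have "measure_pmf.prob (Pi_pmf {..<n} 0 (\<lambda>_. p)) {k. sum k {..<n} \<in> S} =
      1 - measure_pmf.prob (Pi_pmf {..<n} 0 (\<lambda>_. p)) {k. \<bar>real (sum k {..<n}) - c * real n\<bar> \<ge> \<kappa> * real r}"
    by (subst measure_pmf.prob_compl[symmetric])
       (auto simp: S_def intro!: arg_cong[where f = "measure _"])
  then have likely: "1 / 2 \<le> measure_pmf.prob (Pi_pmf {..<n} 0 (\<lambda>_. p)) {k. sum k {..<n} \<in> S}"
    using dev by simp
  have T': "real T = c * real n + c * real r"
    by (simp add: T R'_def n_def algebra_simps)
  have \<kappa>r: "\<kappa> * real r = c * real r - real b * real r"
    by (simp add: \<kappa>_def algebra_simps)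
  \<comment> \<open>The window \<open>S\<close> for the sum over the first \<open>n\<close> sites is
    chosen so that the missing \<open>T - s\<close> particles average between \<open>b\<close> and
    \<open>2 c - b\<close> on the \<open>r\<close> further sites.\<close>
  have S_less: "real s < real T - real b * real r \<and> real T - real s < (2 * c - real b) * real r" if "s \<in> S" for s
    using that T' \<kappa>r by (auto simp: S_def algebra_simps abs_less_iff)
  have "S \<subseteq> {..T}"
  proof
    fix s assume "s \<in> S"
    then have "real s < real T" using S_less[of s] by (smt (verit) of_nat_0_le_iff mult_nonneg_nonneg)
    then show "s \<in> {..T}" by simp
  qed
  from exists_likely_sum[OF likely this] obtain s
    where s: "s \<in> S" "1 / (4 * real (T + 1)) \<le> iid_weight p UNIV n s" by blast
  have "s \<le> T" using \<open>S \<subseteq> {..T}\<close> s(1) by auto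
  have "b * r \<le> T - s" "T - s \<le> B * r"
  proof -
    have "real (b * r) \<le> real (T - s)" using S_less[OF s(1)] \<open>s \<le> T\<close> by (simp add: of_nat_diff)
    then show "b * r \<le> T - s" by (simp only: of_nat_le_iff)
    have "real (T - s) \<le> (2 * c - real b) * real r" using S_less[OF s(1)] \<open>s \<le> T\<close> by (simp add: of_nat_diff)
    also have "\<dots> \<le> real B * real r" using B by (intro mult_right_mono) auto
    finally have "real (T - s) \<le> real (B * r)" by simp
    then show "T - s \<le> B * r" by (simp only: of_nat_le_iff)
  qed
  then have corr: "\<eta> ^ r \<le> iid_weight p UNIV r (T - s)"
    using \<eta>_pos \<eta>_le B by (intro iid_weight_ge_power[where b = b and B = B]) auto
  have "exp (- (\<delta> / 2 * R' * real r)) \<le> 1 / (4 * real (T + 1))"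
  proof -
    have "4 * real (T + 1) \<le> exp (\<delta> / 2 * R' * real r)"
      using r by (simp add: T algebra_simps)
    then show ?thesis
      by (simp add: exp_minus inverse_eq_divide frac_le)
  qed
  moreover have "exp (- (\<delta> / 2 * R' * real r)) \<le> \<eta> ^ r"
  proof -
    have "real r * - ln \<eta> \<le> real r * (\<delta> / 2 * R')"
      using mult_left_mono[OF R, of "real r"] by (simp only: R'_def of_nat_0_le_iff)
    then have "exp (- (\<delta> / 2 * R' * real r)) \<le> exp (real r * ln \<eta>)"
      by (simp only: exp_le_cancel_iff mult_minus_right minus_le_iff mult.commute[of "real r"])
    also have "\<dots> = \<eta> ^ r" using \<eta>_pos by (simp add: exp_of_nat_mult)
    finally show ?thesis .
  qed
  ultimately have "exp (- (\<delta> / 2 * R' * real r)) * exp (- (\<delta> / 2 * R' * real r)) \<le>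
      iid_weight p UNIV n s * iid_weight p UNIV r (T - s)"
    using s corr by (intro mult_mono iid_weight_nonneg) auto
  also have "\<dots> \<le> iid_weight p UNIV (n + r) (s + (T - s))" by (rule iid_weight_add)
  also have "exp (- (\<delta> / 2 * R' * real r)) * exp (- (\<delta> / 2 * R' * real r)) = exp (- \<delta> * real (n + r))"
    by (simp add: n_def R'_def algebra_simps flip: exp_add)
  finally have "exp (- \<delta> * real (n + r)) \<le> iid_weight p UNIV (n + r) T"
    using \<open>s \<le> T\<close> by simp
  moreover have "real T = c * real (n + r)" by (simp add: T' algebra_simps)
  moreover have "n + r > 0" using r by simp
  ultimately show ?thesis by blast
qed

text \<open>
  Concatenating copies of one block with a good weight keeps the set of levels bounded, because every
  occupation number in a block of total \<open>t\<close> is at most \<open>t\<close>.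
\<close>

lemma iid_weight_bounded_levels:
  fixes p :: "nat pmf"
  assumes int: "integrable p (\<lambda>j. (real j)\<^sup>2)" and mean: "measure_pmf.expectation p real = c"
    and supp: "set_pmf p = {b..}" and c: "c > real b" "c \<in> \<rat>" and "\<delta> > 0"
  shows "\<exists>V C. finite V \<and> V \<subseteq> {b..} \<and> C > 0 \<and>
    (\<forall>N t. real t = c * real N \<longrightarrow> C * exp (- \<delta> * real N) \<le> iid_weight p V N t)"
proof -
  from iid_weight_subexponential[OF assms] obtain n0 t0
    where n0: "n0 > 0" "real t0 = c * real n0" "exp (- \<delta> * real n0) \<le> iid_weight p UNIV n0 t0" by blast
  define B where "B = nat \<lceil>c\<rceil>"
  define \<eta> where "\<eta> = Min (pmf p ` {b..B})"
  \<comment> \<open>This contains the levels inside blocks, at most \<open>t0\<close>, and those on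
    leftover sites, at most \<open>B\<close>.\<close>
  define V where "V = {b..t0 + B}"
  have B: "c \<le> real B" "b \<le> B"
    unfolding B_def using c by linarith+
  have \<eta>_pos: "\<eta> > 0" and \<eta>_le: "\<And>x. x \<in> {b..B} \<Longrightarrow> \<eta> \<le> pmf p x"
    unfolding \<eta>_def using B supp by (auto simp: pmf_positive_iff)
  have "\<eta> \<le> 1" using \<eta>_le[of b] B pmf_le_1[of p b] by simp
  have block: "exp (- \<delta> * real n0) \<le> iid_weight p V n0 t0"
  proof -
    define Q where "Q = Pi_pmf {..<n0} 0 (\<lambda>_. p)"
    have "iid_weight p UNIV n0 t0 = measure_pmf.prob Q ({k. sum k {..<n0} = t0} \<inter> set_pmf Q)"
      by (simp add: iid_weight_def Q_def measure_Int_set_pmf)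
    also have "\<dots> \<le> measure_pmf.prob Q {k. sum k {..<n0} = t0 \<and> k ` {..<n0} \<subseteq> V}"
    proof (rule measure_pmf.finite_measure_mono)
      have "k i \<in> V" if "sum k {..<n0} = t0" "k \<in> set_pmf Q" "i < n0" for k i
      proof -
        have "k i \<le> t0" using that member_le_sum[of i "{..<n0}" k] by auto
        moreover have "k i \<ge> b"
          using that supp by (auto simp: Q_def set_Pi_pmf PiE_dflt_def)
        ultimately show ?thesis by (simp add: V_def)
      qed
      then show "{k. sum k {..<n0} = t0} \<inter> set_pmf Q \<subseteq> {k. sum k {..<n0} = t0 \<and> k ` {..<n0} \<subseteq> V}"
        by auto
    qed simp
    finally show ?thesis using n0(3) by (simp add: iid_weight_def Q_def)
  qed
  have "\<eta> ^ n0 * exp (- \<delta> * real N) \<le> iid_weight p V N t" if t: "real t = c * real N" for N t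
  proof -
    \<comment> \<open>There are \<open>q\<close> full blocks and fewer than \<open>n0\<close>
      leftover sites; the total for the latter is again \<open>c r\<close>, hence between
      \<open>b r\<close> and \<open>B r\<close>.\<close>
    define q r where "q = N div n0" and "r = N mod n0"
    have N: "N = q * n0 + r" and r: "r < n0" using n0(1) by (simp_all add: q_def r_def)
    have c0: "c \<ge> 0" using c by simp
    have t': "real t = real (q * t0) + c * real r"
      using t n0(2) by (simp add: N algebra_simps)
    then have "real (q * t0) \<le> real t" using c0 by simp
    then have "q * t0 \<le> t" by (simp only: of_nat_le_iff)
    then have u: "real (t - q * t0) = c * real r" using t' by (simp add: of_nat_diff)
    have "real (b * r) \<le> real (t - q * t0)" "real (t - q * t0) \<le> real (B * r)"
      unfolding u using c B by (auto intro!: mult_right_mono)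
    then have "b * r \<le> t - q * t0" "t - q * t0 \<le> B * r" by (simp_all only: of_nat_le_iff)
    then have "\<eta> ^ r \<le> iid_weight p V r (t - q * t0)"
      using \<eta>_pos \<eta>_le B by (intro iid_weight_ge_power[where b = b and B = B]) (auto simp: V_def)
    \<comment> \<open>The cost of the leftover sites is thus bounded by a constant independent of
      \<open>N\<close>.\<close>
    moreover have "\<eta> ^ n0 \<le> \<eta> ^ r"
      using r \<eta>_pos \<open>\<eta> \<le> 1\<close> by (intro power_decreasing) auto
    ultimately have rest: "\<eta> ^ n0 \<le> iid_weight p V r (t - q * t0)" by simp
    have "exp (- \<delta> * real N) \<le> exp (- \<delta> * real n0) ^ q"
      using \<open>\<delta> > 0\<close> by (simp add: N algebra_simps flip: exp_of_nat_mult)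
    also have "\<dots> \<le> iid_weight p V n0 t0 ^ q"
      by (intro power_mono block) auto
    also have "\<dots> \<le> iid_weight p V (q * n0) (q * t0)" by (rule iid_weight_mult)
    finally have "exp (- \<delta> * real N) * \<eta> ^ n0 \<le> iid_weight p V (q * n0) (q * t0) * iid_weight p V r (t - q * t0)"
      using rest \<eta>_pos by (intro mult_mono iid_weight_nonneg) auto
    also have "\<dots> \<le> iid_weight p V (q * n0 + r) (q * t0 + (t - q * t0))" by (rule iid_weight_add)
    finally show ?thesis using \<open>q * t0 \<le> t\<close> by (simp add: N mult.commute)
  qed
  then show ?thesis
    using \<eta>_pos by (intro exI[of _ V] exI[of _ "\<eta> ^ n0"]) (auto simp: V_def)
qed

section \<open>The conditional limit\<close>

text \<open>The events \<open>k l = j\<close> are independent with probability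
  \<open>pmf p j\<close>, so their number is binomial and Hoeffding's inequality applies.\<close>

lemma site_frequency_deviation:
  fixes p :: "nat pmf"
  assumes "N > 0" and "\<epsilon> \<ge> 0"
  shows "measure_pmf.prob (Pi_pmf {1..N} 0 (\<lambda>_. p))
           {k. \<epsilon> \<le> \<bar>real (card {l \<in> {1..N}. k l = j}) / real N - pmf p j\<bar>} \<le> 2 * exp (-2 * real N * \<epsilon>\<^sup>2)"
proof -
  have bern: "map_pmf (\<lambda>x. x = j) p = bernoulli_pmf (pmf p j)"
  proof (rule pmf_eqI)
    fix x
    have "pmf (map_pmf (\<lambda>x. x = j) p) True = pmf p j"
      by (simp add: pmf_map vimage_def pmf.rep_eq)
    then show "pmf (map_pmf (\<lambda>x. x = j) p) x = pmf (bernoulli_pmf (pmf p j)) x"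
      using pmf_False_conv_True[of "map_pmf (\<lambda>x. x = j) p"] by (cases x) (simp_all add: pmf_le_1)
  qed
  have "binomial_pmf N (pmf p j) = map_pmf (\<lambda>f. card {l \<in> {1..N}. f l})
      (Pi_pmf {1..N} (0 = j) (\<lambda>_. bernoulli_pmf (pmf p j)))"
    by (rule binomial_pmf_altdef') (auto simp: pmf_le_1)
  also have "Pi_pmf {1..N} (0 = j) (\<lambda>_. bernoulli_pmf (pmf p j)) =
      map_pmf (\<lambda>h. (\<lambda>x. x = j) \<circ> h) (Pi_pmf {1..N} 0 (\<lambda>_. p))"
    unfolding bern[symmetric] by (rule Pi_pmf_map) auto
  finally have binom: "binomial_pmf N (pmf p j) =
      map_pmf (\<lambda>k. card {l \<in> {1..N}. k l = j}) (Pi_pmf {1..N} 0 (\<lambda>_. p))"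
    by (simp add: pmf.map_comp o_def)
  interpret binomial_distribution N "pmf p j"
    by unfold_locales (simp add: pmf_le_1)
  show ?thesis
    using prob_abs_ge'[of \<epsilon>] assms by (simp add: binom vimage_def)
qed

text \<open>Swapping two sites preserves the product law as well as the sum, the lower bound and the
  image that define the profiles.\<close>

lemma transpose_site_prob:
  assumes l: "l \<in> {1..N}" "l' \<in> {1..N}"
  shows "measure_pmf.prob (Pi_pmf {1..N} 0 (\<lambda>_. p)) (occupation_profiles N K b M \<inter> {k. k l = j}) =
         measure_pmf.prob (Pi_pmf {1..N} 0 (\<lambda>_. p)) (occupation_profiles N K b M \<inter> {k. k l' = j})"
proof -
  define \<tau> where "\<tau> = Transposition.transpose l l'"
  have \<tau>: "bij_betw \<tau> {1..N} {1..N}"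
    unfolding \<tau>_def using l by (auto simp: bij_betw_transpose_iff)
  have inv: "k \<circ> \<tau> \<in> occupation_profiles N K b M \<longleftrightarrow> k \<in> occupation_profiles N K b M" for k
  proof -
    have "(\<Sum>i\<in>{1..N}. (k \<circ> \<tau>) i) = (\<Sum>i\<in>{1..N}. k i)"
      using sum.reindex_bij_betw[OF \<tau>, of k] by simp
    moreover have image: "(k \<circ> \<tau>) ` {1..N} = k ` {1..N}"
      using bij_betw_imp_surj_on[OF \<tau>] by (metis image_comp)
    moreover have "(\<forall>i\<in>{1..N}. b \<le> (k \<circ> \<tau>) i) \<longleftrightarrow> (\<forall>i\<in>{1..N}. b \<le> k i)"
    proof -
      have "(\<forall>i\<in>{1..N}. b \<le> f i) \<longleftrightarrow> f ` {1..N} \<subseteq> {b..}" for f :: "nat \<Rightarrow> nat" by auto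
      then show ?thesis by (simp only: image)
    qed
    ultimately show ?thesis by (simp only: occupation_profiles_def mem_Collect_eq)
  qed
  have "Pi_pmf {1..N} 0 (\<lambda>_. p) = map_pmf (\<lambda>g. g \<circ> \<tau>) (Pi_pmf {1..N} 0 (\<lambda>_. p))"
    by (rule Pi_pmf_bij_betw[OF _ \<tau>]) (use l in \<open>auto simp: \<tau>_def transpose_def split: if_splits\<close>)
  then have "measure_pmf.prob (Pi_pmf {1..N} 0 (\<lambda>_. p)) (occupation_profiles N K b M \<inter> {k. k l = j}) =
      measure_pmf.prob (map_pmf (\<lambda>g. g \<circ> \<tau>) (Pi_pmf {1..N} 0 (\<lambda>_. p)))
        (occupation_profiles N K b M \<inter> {k. k l = j})"
    by simp
  also have "\<dots> = measure_pmf.prob (Pi_pmf {1..N} 0 (\<lambda>_. p))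
        ((\<lambda>g. g \<circ> \<tau>) -` (occupation_profiles N K b M \<inter> {k. k l = j}))"
    by (rule measure_map_pmf)
  also have "(\<lambda>g. g \<circ> \<tau>) -` (occupation_profiles N K b M \<inter> {k. k l = j}) =
      occupation_profiles N K b M \<inter> {k. k l' = j}"
    using inv by (auto simp: \<tau>_def)
  finally show ?thesis .
qed

text \<open>
  By exchangeability of the sites the probability of \<open>k l = j\<close> is the mean frequency of the level \<open>j\<close>.
\<close>

lemma conditional_site_prob:
  fixes p :: "nat pmf" and N K b M l j :: nat and \<epsilon> :: real
  assumes l: "l \<in> {1..N}" and "\<epsilon> > 0"
  defines "Q \<equiv> Pi_pmf {1..N} 0 (\<lambda>_. p)" and "C \<equiv> occupation_profiles N K b M"
  assumes pos: "measure_pmf.prob Q C > 0"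
  shows "\<bar>measure_pmf.prob Q (C \<inter> {k. k l = j}) / measure_pmf.prob Q C - pmf p j\<bar> \<le>
           \<epsilon> + 2 * exp (-2 * real N * \<epsilon>\<^sup>2) / measure_pmf.prob Q C"
proof -
  have N: "N > 0" using l by simp
  define X where "X = (\<lambda>k :: nat \<Rightarrow> nat. real (card {l \<in> {1..N}. k l = j}) / real N)"
  define F where "F = {k. \<epsilon> \<le> \<bar>X k - pmf p j\<bar>}"
  have X: "0 \<le> X k" "X k \<le> 1" for k
  proof -
    have "card {l \<in> {1..N}. k l = j} \<le> card {1..N}" by (rule card_mono) auto
    then show "0 \<le> X k" "X k \<le> 1" using N by (simp_all add: X_def divide_le_eq_1)
  qed
  have bnd: "\<bar>X k - pmf p j\<bar> \<le> 1" for k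
    using X[of k] pmf_le_1[of p j] pmf_nonneg[of p j] by linarith
  have int: "integrable Q f" if "\<And>k. \<bar>f k\<bar> \<le> 1" for f :: "(nat \<Rightarrow> nat) \<Rightarrow> real"
    by (rule measure_pmf.integrable_const_bound[where B = 1]) (use that in auto)
  have exp_C: "measure_pmf.expectation Q (\<lambda>k. indicator C k * X k) = measure_pmf.prob Q (C \<inter> {k. k l = j})"
  proof -
    have X_sum: "X k = (\<Sum>i\<in>{1..N}. indicator {k. k i = j} k) / real N" for k
      by (simp add: X_def indicator_def sum.If_cases Int_def conj_commute)
    have "indicator C k * X k = (\<Sum>i\<in>{1..N}. indicator (C \<inter> {k. k i = j}) k) / real N" for k
      unfolding X_sum by (simp add: sum_distrib_left indicator_inter_arith)
    then have "measure_pmf.expectation Q (\<lambda>k. indicator C k * X k) =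
        (\<Sum>i\<in>{1..N}. measure_pmf.prob Q (C \<inter> {k. k i = j})) / real N"
      by (simp add: int)
    also have "(\<Sum>i\<in>{1..N}. measure_pmf.prob Q (C \<inter> {k. k i = j})) =
        (\<Sum>i\<in>{1..N}. measure_pmf.prob Q (C \<inter> {k. k l = j}))"
      unfolding Q_def C_def by (intro sum.cong refl transpose_site_prob l)
    finally show ?thesis using N by simp
  qed
  have int': "integrable Q (\<lambda>k. indicator C k * X k)" "integrable Q (indicator C :: _ \<Rightarrow> real)"
      "integrable Q (indicator F :: _ \<Rightarrow> real)"
    using X by (auto intro!: int simp: indicator_def abs_le_iff intro: order_trans[OF _ X(1)])
  have "measure_pmf.prob Q (C \<inter> {k. k l = j}) - pmf p j * measure_pmf.prob Q C =
      measure_pmf.expectation Q (\<lambda>k. indicator C k * X k - pmf p j * indicator C k)"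
    using int' exp_C by simp
  also have "\<bar>\<dots>\<bar> \<le> measure_pmf.expectation Q (\<lambda>k. \<bar>indicator C k * X k - pmf p j * indicator C k\<bar>)"
    by (rule integral_abs_bound)
  also have "\<dots> \<le> measure_pmf.expectation Q (\<lambda>k. \<epsilon> * indicator C k + indicator F k)"
  proof (rule integral_mono)
    \<comment> \<open>Off \<open>F\<close> the frequency is within \<open>\<epsilon>\<close> of
      \<open>pmf p j\<close>; on \<open>F\<close> their difference is at most
      \<open>1\<close>.\<close>
    show "\<bar>indicator C k * X k - pmf p j * indicator C k\<bar> \<le> \<epsilon> * indicator C k + indicator F k" for k
      using bnd[of k] \<open>\<epsilon> > 0\<close> by (auto simp: indicator_def F_def)
  qed (use int' in auto)
  also have "\<dots> = \<epsilon> * measure_pmf.prob Q C + measure_pmf.prob Q F"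
    using int' by simp
  also have "\<dots> \<le> \<epsilon> * measure_pmf.prob Q C + 2 * exp (-2 * real N * \<epsilon>\<^sup>2)"
    using site_frequency_deviation[OF N, of \<epsilon> p j] \<open>\<epsilon> > 0\<close> by (simp add: F_def X_def Q_def)
  finally have "\<bar>measure_pmf.prob Q (C \<inter> {k. k l = j}) - pmf p j * measure_pmf.prob Q C\<bar> / measure_pmf.prob Q C
      \<le> (\<epsilon> * measure_pmf.prob Q C + 2 * exp (-2 * real N * \<epsilon>\<^sup>2)) / measure_pmf.prob Q C"
    using pos by (intro divide_right_mono) auto
  moreover have "\<bar>measure_pmf.prob Q (C \<inter> {k. k l = j}) / measure_pmf.prob Q C - pmf p j\<bar> =
      \<bar>measure_pmf.prob Q (C \<inter> {k. k l = j}) - pmf p j * measure_pmf.prob Q C\<bar> / measure_pmf.prob Q C"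
  proof -
    have "measure_pmf.prob Q (C \<inter> {k. k l = j}) / measure_pmf.prob Q C - pmf p j =
        (measure_pmf.prob Q (C \<inter> {k. k l = j}) - pmf p j * measure_pmf.prob Q C) / measure_pmf.prob Q C"
      using pos by (simp add: diff_divide_distrib)
    then show ?thesis using pos by simp
  qed
  ultimately show ?thesis using pos by (simp add: add_divide_distrib)
qed

text \<open>The prefactor of the counting formula cancels in the quotient. Taking
  \<open>E = UNIV\<close> gives the denominator, whose positivity also shows that the uniform
  distribution lives on a nonempty set.\<close>

lemma prob_microcanonical:
  assumes "\<alpha> > 0" and "measure_pmf.prob (Pi_pmf {1..N} 0 (\<lambda>_. rho b \<alpha>)) (occupation_profiles N K b M) > 0"
  shows "measure_pmf.prob (microcanonical N K b M) {\<omega>. occupation K \<omega> \<in> E} =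
    measure_pmf.prob (Pi_pmf {1..N} 0 (\<lambda>_. rho b \<alpha>)) (occupation_profiles N K b M \<inter> E) /
    measure_pmf.prob (Pi_pmf {1..N} 0 (\<lambda>_. rho b \<alpha>)) (occupation_profiles N K b M)"
proof -
  define R where "R = restricted_configs N K b M"
  define w where "w = fact K * Z b \<alpha> ^ N / \<alpha> ^ K"
  have w: "w > 0" using assms(1) Z_pos[of \<alpha> b] by (simp add: w_def)
  note card = card_restricted_configs_conv_Pi_pmf[where p = "rho b \<alpha>" and b = b,
      OF assms(1) pmf_rho[OF assms(1)], of N K M, folded R_def w_def]
  have cardR: "real (card R) = w * measure_pmf.prob (Pi_pmf {1..N} 0 (\<lambda>_. rho b \<alpha>)) (occupation_profiles N K b M)"
    using card[of UNIV] by simp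
  have fin: "finite R" unfolding R_def restricted_configs_def by (simp add: finite_configs)
  have "real (card R) > 0" unfolding cardR using w assms(2) by simp
  then have "R \<noteq> {}" by auto
  then have "measure_pmf.prob (microcanonical N K b M) {\<omega>. occupation K \<omega> \<in> E} =
      real (card {\<omega> \<in> R. occupation K \<omega> \<in> E}) / real (card R)"
    unfolding microcanonical_def R_def[symmetric] using fin
    by (subst measure_pmf_of_set) (auto simp: Int_def)
  then show ?thesis using w by (simp only: card cardR) simp
qed

theorem corollary2p3:
  fixes b j l :: nat and c :: real and m :: "nat \<Rightarrow> nat"
  assumes "c \<in> \<rat>" and "c > real b"
    and "\<And>N. N \<in> admissible c \<Longrightarrow> 2 \<le> m N \<and> m N \<le> N"
    and "filterlim m at_top (thermodynamic c)"
    and "((\<lambda>N. (real (m N))\<^sup>2 / real N) \<longlongrightarrow> 0) (thermodynamic c)"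
    and "l \<ge> 1" and "j \<in> {b..}"
  shows "((\<lambda>N. measure_pmf.prob (microcanonical N (num_particles c N) b (m N))
              {\<omega>. occupation (num_particles c N) \<omega> l = j})
            \<longlongrightarrow> pmf (rho b (alpha b c)) j) (thermodynamic c)
         \<and> pmf (rho b (alpha b c)) j = 1 / Z b (alpha b c) * (alpha b c ^ j / fact j)"
proof
  note \<alpha> = alpha[OF assms(2)]
  define p where "p = rho b (alpha b c)"
  define prob where "prob N = measure_pmf.prob (microcanonical N (num_particles c N) b (m N))
      {\<omega>. occupation (num_particles c N) \<omega> l = j}" for N
  show "pmf (rho b (alpha b c)) j = 1 / Z b (alpha b c) * (alpha b c ^ j / fact j)"
    using pmf_rho[OF \<alpha>(1)] assms(7) by simp
  show "(prob \<longlongrightarrow> pmf (rho b (alpha b c)) j) (thermodynamic c)"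
  proof (rule tendstoI)
    fix e :: real assume "e > 0"
    \<comment> \<open>One half of \<open>e\<close> is the frequency tolerance, the other is for the
      exceptional event.\<close>
    define \<epsilon> where "\<epsilon> = e / 2"
    have \<epsilon>: "\<epsilon> > 0" using \<open>e > 0\<close> by (simp add: \<epsilon>_def)
    \<comment> \<open>The rate \<open>\<epsilon>^2\<close> is half of Hoeffding's
      \<open>2 \<epsilon>^2\<close>, so the quotient of the two bounds still decays
      exponentially.\<close>
    obtain V C where VC: "finite V" "V \<subseteq> {b..}" "C > 0"
      "\<And>N t. real t = c * real N \<Longrightarrow> C * exp (- (\<epsilon>\<^sup>2) * real N) \<le> iid_weight p V N t"
      using iid_weight_bounded_levels[OF integrable_square_rho[OF \<alpha>(1)] \<alpha>(2) set_pmf_rho[OF \<alpha>(1)]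
          assms(2,1), of "\<epsilon>\<^sup>2"] \<epsilon> unfolding p_def by auto
    have "eventually (\<lambda>N. 2 / C * exp (- (\<epsilon>\<^sup>2) * real N) < \<epsilon>) sequentially"
      using \<epsilon> VC(3) by real_asymp
    then have "eventually (\<lambda>N. 2 / C * exp (- (\<epsilon>\<^sup>2) * real N) < \<epsilon> \<and> N \<ge> l) sequentially"
      by (intro eventually_conj eventually_ge_at_top)
    then have "eventually (\<lambda>N. 2 / C * exp (- (\<epsilon>\<^sup>2) * real N) < \<epsilon> \<and> N \<ge> l) (thermodynamic c)"
      unfolding thermodynamic_def by (rule filter_leD[rotated]) simp
    \<comment> \<open>\<open>V\<close> is fixed while \<open>m\<close> tends to infinity, so
      profiles with values in \<open>V\<close> eventually meet the constraint on the number of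
      levels.\<close>
    moreover have "eventually (\<lambda>N. m N \<ge> card V) (thermodynamic c)"
      using assms(4) by (simp add: filterlim_at_top)
    moreover have "eventually (\<lambda>N. N \<in> admissible c) (thermodynamic c)"
      unfolding thermodynamic_def by (simp add: eventually_inf_principal)
    ultimately show "eventually (\<lambda>N. dist (prob N) (pmf (rho b (alpha b c)) j) < e) (thermodynamic c)"
    proof eventually_elim
      case (elim N)
      define K where "K = num_particles c N"
      define Q where "Q = Pi_pmf {1..N} 0 (\<lambda>_. p)"
      define D where "D = measure_pmf.prob Q (occupation_profiles N K b (m N))"
      have "real K = c * real N"
        unfolding K_def using assms(2) elim by (intro real_num_particles) auto
      then have "C * exp (- (\<epsilon>\<^sup>2) * real N) \<le> iid_weight p V N K" by (rule VC(4))
      also have "\<dots> = measure_pmf.prob Q {k. sum k {1..N} = K \<and> k ` {1..N} \<subseteq> V}"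
        unfolding Q_def by (rule iid_weight_index_set[symmetric]) auto
      also have "\<dots> \<le> D"
        unfolding D_def
      proof (rule measure_pmf.finite_measure_mono)
        show "{k. sum k {1..N} = K \<and> k ` {1..N} \<subseteq> V} \<subseteq> occupation_profiles N K b (m N)"
        proof
          fix k assume "k \<in> {k. sum k {1..N} = K \<and> k ` {1..N} \<subseteq> V}"
          then have k: "sum k {1..N} = K" "k ` {1..N} \<subseteq> V" by auto
          have "card (k ` {1..N}) \<le> m N"
            using card_mono[OF VC(1) k(2)] elim by linarith
          then show "k \<in> occupation_profiles N K b (m N)"
            using k VC(2) by (auto simp: occupation_profiles_def)
        qed
      qed simp
      finally have D: "C * exp (- (\<epsilon>\<^sup>2) * real N) \<le> D" .
      have "0 < C * exp (- (\<epsilon>\<^sup>2) * real N)" using VC(3) by simp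
      then have "D > 0" using D by linarith
      have "prob N = measure_pmf.prob Q (occupation_profiles N K b (m N) \<inter> {k. k l = j}) / D"
        using prob_microcanonical[OF \<alpha>(1), of N b K "m N" "{k. k l = j}"] \<open>D > 0\<close>
        by (simp add: prob_def Q_def D_def K_def p_def)
      then have "\<bar>prob N - pmf p j\<bar> \<le> \<epsilon> + 2 * exp (-2 * real N * \<epsilon>\<^sup>2) / D"
        using conditional_site_prob[of l N \<epsilon> p K b "m N" j] \<open>D > 0\<close> \<epsilon> elim assms(6)
        by (simp add: Q_def D_def)
      also have "2 * exp (-2 * real N * \<epsilon>\<^sup>2) / D \<le>
          2 * exp (-2 * real N * \<epsilon>\<^sup>2) / (C * exp (- (\<epsilon>\<^sup>2) * real N))"
        using D \<open>0 < C * _\<close> by (intro divide_left_mono) auto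
      also have "\<dots> = 2 / C * exp (- (\<epsilon>\<^sup>2) * real N)"
      proof -
        have "exp (-2 * real N * \<epsilon>\<^sup>2) = exp (- (\<epsilon>\<^sup>2) * real N) * exp (- (\<epsilon>\<^sup>2) * real N)"
          by (simp add: algebra_simps flip: exp_add)
        then show ?thesis by simp
      qed
      also have "\<dots> < \<epsilon>" using elim by simp
      finally show ?case by (simp add: dist_real_def p_def \<epsilon>_def)
    qed
  qed
qed

end
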